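(* Let $G$ be a connected graph of order $n$, minimum degree $\delta$ and maximum degree $\Delta$. Then \[ {\rm avec}(G)\leq \frac{9}{4}\,\frac{n-\Delta-1}{\delta+1}\Big(1+\frac{\Delta-\delta}{3n}\Big)+7 . \] Moreover, this bound is sharp apart from the value of the additive constant: there is a constant $C$ such that for all integers $\delta\ge 1$ and $\Delta\ge \delta+1$ there are connected graphs $G$ of minimum degree $\delta$, maximum degree $\Delta$ and arbitrarily large order $n$ with ${\rm avec}(G)\ge \frac{9}{4}\frac{n-\Delta-1}{\delta+1}\big(1+\frac{\Delta-\delta}{3n}\big)-C$.
   Context: All graphs are finite and simple. For a connected graph $G$ and a vertex $v$, the eccentricity $e(v)$ is the largest distance from $v$ to a vertex of $G$. The average eccentricity is ${\rm avec}(G)=\frac{1}{|V(G)|}\sum_{v\in V(G)}e(v)$.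
   Formalization: Sharpness is stated for δ ≥ 2 instead of δ ≥ 1: for δ = 1 it is false for every Δ, since avec(G) ≤ n−1 while the claimed lower bound grows like 9n/8. *)

theory Defs
  imports Complex_Main "Graph_Theory.Graph_Theory"
begin

text \<open>
  A finite simple graph is a \<^term>\<open>graph\<close> of the AFP entry Graph-Theory: a finite symmetric
  digraph without loops and parallel arcs.  Each undirected edge is a pair of opposite arcs, so
  the degree of a vertex is its out-degree.
\<close>

definition min_degree :: "('a, 'b) pre_digraph \<Rightarrow> nat" where
  "min_degree G = Min (out_degree G ` verts G)"

definition max_degree :: "('a, 'b) pre_digraph \<Rightarrow> nat" where
  "max_degree G = Max (out_degree G ` verts G)"

text \<open>
  \<^term>\<open>wf_digraph.\<mu> G w u v\<close> is the least \<open>w\<close>-cost of a walk from \<open>u\<close> to \<open>v\<close>, and infinite if there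
  is none.  With unit costs it is the graph distance; in a connected graph it is finite, so
  that the conversion to reals loses nothing.
\<close>

definition graph_dist :: "('a, 'b) pre_digraph \<Rightarrow> 'a \<Rightarrow> 'a \<Rightarrow> real" where
  "graph_dist G u v = real_of_ereal (wf_digraph.\<mu> G (\<lambda>_. 1) u v)"

definition eccentricity :: "('a, 'b) pre_digraph \<Rightarrow> 'a \<Rightarrow> real" where
  "eccentricity G v = Max (graph_dist G v ` verts G)"

definition avec :: "('a, 'b) pre_digraph \<Rightarrow> real" where
  "avec G = (\<Sum>v\<in>verts G. eccentricity G v) / real (card (verts G))"

definition avec_bound :: "nat \<Rightarrow> nat \<Rightarrow> nat \<Rightarrow> real" where
  "avec_bound n \<delta> \<Delta> =
     9 / 4 * ((real n - real \<Delta> - 1) / (real \<delta> + 1)) * (1 + (real \<Delta> - real \<delta>) / (3 * real n))"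

text \<open>
  For minimum degree 1 the bound is not sharp up to an additive constant: always
  \<open>avec G \<le> n - 1\<close>, whereas \<open>avec_bound n 1 \<Delta>\<close> grows like \<open>9 / 8 * n\<close>.  Sharpness is a meaningful
  assertion only for \<open>\<delta> \<ge> 2\<close>.
\<close>

end

theory Submission
  imports Defs
begin

text \<open>
  Upper bound: starting from a vertex of maximum degree, greedily choose vertices at distance
  exactly 3 from the set chosen so far. The closed neighbourhoods of the chosen set \<open>A\<close> are
  disjoint, so that \<open>card A\<close> is at most \<open>1 + (n - \<Delta> - 1) / (\<delta> + 1)\<close>, and every vertex is within
  distance 2 of \<open>A\<close>. Joining each new vertex to one that it is at distance 3 from makes \<open>A\<close> a
  tree, and distances in the graph exceed three times tree distances by at most 4. Each vertex
  moves its weight to a nearby element of \<open>A\<close>, which thus receives at least \<open>\<delta> + 1\<close>. The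
  minimum weights contribute \<open>\<delta> + 1\<close> times the sum of tree eccentricities, about
  \<open>3 / 4 * (card A)\<^sup>2\<close> at most (as for a path); the excess weight is estimated by eccentricity
  \<open>card A - 1\<close>. The resulting expression increases with \<open>card A\<close>.

  Sharpness: a clique of order \<open>\<Delta> - 1\<close> followed by a long chain of layers of orders
  \<open>1, 1, \<delta> - 1\<close>, with consecutive layers completely joined.
\<close>

section \<open>Tree metrics\<close>

text \<open>A tree is encoded by its distance function alone, grown leaf by leaf; values of
  \<open>t\<close> outside \<open>A\<close> carry no meaning. This matches the growth of a packing
  and allows eccentricity sums to be bounded by induction on the leaves.\<close>

inductive tree_metric :: "'a set \<Rightarrow> ('a \<Rightarrow> 'a \<Rightarrow> nat) \<Rightarrow> bool" where
  single: "tree_metric {r} (\<lambda>_ _. 0)"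
| leaf: "\<lbrakk>tree_metric A t; p \<in> A; x \<notin> A\<rbrakk> \<Longrightarrow> tree_metric (insert x A)
    (\<lambda>u v. if u = x then if v = x then 0 else Suc (t p v)
           else if v = x then Suc (t u p) else t u v)"

lemma tree_metric_finite: "tree_metric A t \<Longrightarrow> finite A"
  by (induction rule: tree_metric.induct) auto

lemma tree_metric_nonempty: "tree_metric A t \<Longrightarrow> A \<noteq> {}"
  by (induction rule: tree_metric.induct) auto

lemma tree_metric_sym: "tree_metric A t \<Longrightarrow> u \<in> A \<Longrightarrow> v \<in> A \<Longrightarrow> t u v = t v u"
  by (induction arbitrary: u v rule: tree_metric.induct) auto

text \<open>A path with one end at the new leaf \<open>x\<close> passes through its neighbour
  \<open>p\<close>. The induction hypothesis is applied at \<open>p\<close>, with the position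
  shifted by one if \<open>x\<close> comes first; if \<open>x\<close> comes last, it is itself the
  one additional point.\<close>

lemma tree_metric_geodesic:
  "tree_metric A t \<Longrightarrow> u \<in> A \<Longrightarrow> v \<in> A \<Longrightarrow> i \<le> t u v \<Longrightarrow>
    \<exists>z\<in>A. t u z = i \<and> t z v = t u v - i"
proof (induction arbitrary: u v i rule: tree_metric.induct)
  case (single r)
  then show ?case by auto
next
  case (leaf A t p x)
  let ?t = "\<lambda>u v. if u = x then if v = x then 0 else Suc (t p v)
           else if v = x then Suc (t u p) else t u v"
  have A: ?case if "u \<in> A" "v \<in> A"
  proof -
    have "u \<noteq> x" "v \<noteq> x" using that leaf.hyps by auto
    then have "i \<le> t u v" using leaf.prems(3) by simp
    from leaf.IH[OF that this] obtain z where "z \<in> A" "t u z = i" "t z v = t u v - i" by auto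
    moreover have "z \<noteq> x" using leaf.hyps \<open>z \<in> A\<close> by auto
    ultimately show ?thesis using \<open>u \<noteq> x\<close> \<open>v \<noteq> x\<close> by auto
  qed
  have B: ?case if "u = x" "v = x"
    using that leaf.prems(3) by auto
  have C: ?case if "u = x" "v \<in> A"
  proof (cases i)
    case 0
    then show ?thesis using that leaf.hyps by (intro bexI[of _ x]) auto
  next
    case (Suc j)
    have "v \<noteq> x" using that leaf.hyps by auto
    then have "j \<le> t p v" using leaf.prems(3) that Suc by simp
    from leaf.IH[OF leaf.hyps(2) that(2) this] obtain z
      where "z \<in> A" "t p z = j" "t z v = t p v - j" by auto
    moreover have "z \<noteq> x" using leaf.hyps \<open>z \<in> A\<close> by auto
    ultimately show ?thesis using that Suc \<open>v \<noteq> x\<close> by (intro bexI[of _ z]) auto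
  qed
  have D: ?case if "u \<in> A" "v = x"
  proof (cases "i \<le> t u p")
    case True
    have "u \<noteq> x" using that leaf.hyps by auto
    from leaf.IH[OF that(1) leaf.hyps(2) True] obtain z
      where "z \<in> A" "t u z = i" "t z p = t u p - i" by auto
    moreover have "z \<noteq> x" using leaf.hyps \<open>z \<in> A\<close> by auto
    ultimately show ?thesis using that \<open>u \<noteq> x\<close> True by (intro bexI[of _ z]) auto
  next
    case False
    have "u \<noteq> x" using that leaf.hyps by auto
    then have "i = Suc (t u p)" using leaf.prems(3) that False by simp
    then show ?thesis using that \<open>u \<noteq> x\<close> by (intro bexI[of _ x]) auto
  qed
  show ?case using A B C D leaf.prems by blast
qed

lemma tree_metric_less_card:
  "tree_metric A t \<Longrightarrow> u \<in> A \<Longrightarrow> v \<in> A \<Longrightarrow> t u v < card A"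
proof (induction arbitrary: u v rule: tree_metric.induct)
  case (leaf A t p x)
  then have "finite A" by (simp add: tree_metric_finite)
  with leaf show ?case by (auto simp: less_SucI)
qed simp

text \<open>
  On a longest path from \<open>p\<close>, the vertices in the half nearer to \<open>p\<close> are closer to \<open>p\<close> than to the
  other end. The remaining vertices are the only ones whose eccentricity can grow when a leaf is
  attached at \<open>p\<close>.
\<close>

lemma tree_metric_near_half:
  assumes t: "tree_metric A t" and p: "p \<in> A"
  shows "Max (t p ` A) \<le> 2 * card {u \<in> A. t u p < Max (t u ` A)}"
proof -
  note fin = tree_metric_finite[OF t]
  let ?e = "Max (t p ` A)" and ?U = "{u \<in> A. t u p < Max (t u ` A)}"
  have "?e \<in> t p ` A" using fin p by (intro Max_in) auto
  then obtain q where q: "q \<in> A" "t p q = ?e" by auto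
  \<comment> \<open>Positions with \<open>i < ?e - i\<close>, so that the point is closer to
    \<open>p\<close> than to \<open>q\<close>. Different positions give different points because
    \<open>t p (z i) = i\<close>.\<close>
  let ?I = "{i. 2 * i < ?e}"
  have "\<forall>i\<in>?I. \<exists>z\<in>A. t p z = i \<and> t z q = ?e - i"
    using tree_metric_geodesic[OF t p q(1)] q(2) by simp
  then obtain z where z: "\<And>i. i \<in> ?I \<Longrightarrow> z i \<in> A \<and> t p (z i) = i \<and> t (z i) q = ?e - i"
    by metis
  have "inj_on z ?I"
    by (rule inj_onI) (metis z)
  moreover have "z ` ?I \<subseteq> ?U"
  proof
    fix w assume "w \<in> z ` ?I"
    then obtain i where i: "2 * i < ?e" "w = z i" by auto
    then have w: "w \<in> A" "t p w = i" "t w q = ?e - i" using z[of i] by auto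
    have "t w q \<le> Max (t w ` A)" using fin q by simp
    then show "w \<in> ?U" using w i tree_metric_sym[OF t p w(1)] by simp
  qed
  ultimately have "card ?I \<le> card ?U" using fin by (intro card_inj_on_le[of z]) auto
  moreover have "?I = {..<(?e + 1) div 2}" by auto
  ultimately show ?thesis by simp
qed

text \<open>A leaf attached at \<open>p\<close> contributes its own eccentricity, at most
  \<open>?e p + 1\<close>, and raises that of each vertex outside \<open>?U\<close> by at most 1. By
  \<open>tree_metric_near_half\<close> and \<open>?e p < card A\<close>, four times this increase is
  at most \<open>6 * card A + 2\<close>, exactly the growth of
  \<open>3 * card A * card A - card A\<close>.\<close>

lemma tree_metric_sum_Max_le:
  "tree_metric A t \<Longrightarrow> 4 * (\<Sum>u\<in>A. Max (t u ` A)) + card A + 2 \<le> 3 * card A * card A"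
proof (induction rule: tree_metric.induct)
  case (leaf A t p x)
  let ?t = "\<lambda>u v. if u = x then if v = x then 0 else Suc (t p v)
           else if v = x then Suc (t u p) else t u v"
  note fin = tree_metric_finite[OF leaf.hyps(1)] and ne = tree_metric_nonempty[OF leaf.hyps(1)]
  let ?e = "\<lambda>u. Max (t u ` A)" and ?U = "{u \<in> A. t u p < Max (t u ` A)}"
  have x: "Max (?t x ` insert x A) \<le> ?e p + 1"
    using fin ne leaf.hyps by (intro Max.boundedI) (auto split: if_splits)
  have A: "Max (?t u ` insert x A) \<le> (if u \<in> ?U then ?e u else Suc (?e u))" if u: "u \<in> A" for u
  proof (intro Max.boundedI)
    fix y assume "y \<in> ?t u ` insert x A"
    moreover have "u \<noteq> x" using u leaf by auto
    ultimately have "y = Suc (t u p) \<or> y \<in> t u ` A" by (auto split: if_splits)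
    moreover have "t u p \<le> ?e u" using fin leaf.hyps by simp
    moreover have "y \<le> ?e u" if "y \<in> t u ` A" using that fin by simp
    ultimately show "y \<le> (if u \<in> ?U then ?e u else Suc (?e u))" using u by auto
  qed (use fin in auto)
  have "(\<Sum>u\<in>A. Max (?t u ` insert x A)) \<le> (\<Sum>u\<in>A. if u \<in> ?U then ?e u else Suc (?e u))"
    by (rule sum_mono) (rule A)
  also have "\<dots> = (\<Sum>u\<in>A. ?e u + (if u \<in> A - ?U then 1 else 0))"
    by (rule sum.cong) auto
  also have "\<dots> = sum ?e A + sum (\<lambda>_. 1) {u \<in> A. u \<in> A - ?U}"
    using fin by (simp only: sum.distrib sum.inter_filter)
  also have "{u \<in> A. u \<in> A - ?U} = A - ?U" by auto
  finally have S: "(\<Sum>u\<in>A. Max (?t u ` insert x A)) \<le> sum ?e A + card (A - ?U)"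
    by simp
  have U: "card (A - ?U) + card ?U = card A"
    using fin by (subst card_Un_disjoint[symmetric]) (auto intro: arg_cong[where f=card])
  have half: "?e p \<le> 2 * card ?U" by (rule tree_metric_near_half) (use leaf in auto)
  have "?e p < card A"
    using fin ne leaf.hyps by (auto simp: tree_metric_less_card)
  then have "2 * card (A - ?U) + 2 * ?e p + 2 \<le> 3 * card A + 1"
    using half U by linarith
  moreover have "(\<Sum>u\<in>insert x A. Max (?t u ` insert x A)) =
      Max (?t x ` insert x A) + (\<Sum>u\<in>A. Max (?t u ` insert x A))"
    using fin leaf.hyps(3) by (rule sum.insert)
  ultimately have "4 * (\<Sum>u\<in>insert x A. Max (?t u ` insert x A)) \<le> 4 * sum ?e A + 6 * card A + 2"
    using S x by linarith
  moreover have "card (insert x A) = Suc (card A)" using fin leaf by simp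
  ultimately show ?case using leaf.IH by (simp add: algebra_simps)
qed simp

section \<open>The upper bound\<close>

locale connected_graph = graph G for G :: "('a, 'b) pre_digraph" (structure) +
  assumes connected: "Digraph_Component.connected G"
begin

lemma verts_nonempty: "verts G \<noteq> {}"
  using connected by (auto simp: connected_conv)

lemma reachable_verts: "u \<in> verts G \<Longrightarrow> v \<in> verts G \<Longrightarrow> u \<rightarrow>\<^sup>* v"
  using symmetric_connected_imp_strongly_connected[OF sym_arcs connected]
  by (auto simp: strongly_connected_def)

section \<open>Distances and eccentricities in a connected graph\<close>

lemma awalk_cost_unit: "awalk_cost (\<lambda>_. 1) p = length p"
  by (induction p) auto

lemma graph_dist_awalk:
  assumes "u \<in> verts G" "v \<in> verts G"
  obtains p where "awalk u p v" "graph_dist G u v = length p"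
proof -
  obtain p where "apath u p v" "\<mu> (\<lambda>_. 1) u v = awalk_cost (\<lambda>_. 1) p"
    using min_cost_awalk[OF reachable_verts[OF assms], of "\<lambda>_. 1"] by auto
  then show thesis
    by (intro that[of p]) (auto simp: graph_dist_def awalk_cost_unit apath_def)
qed

lemma graph_dist_le_length:
  assumes "awalk u p v"
  shows "graph_dist G u v \<le> length p"
proof -
  have "u \<in> verts G" "v \<in> verts G" using assms by auto
  then obtain q where "apath u q v" "\<mu> (\<lambda>_. 1) u v = awalk_cost (\<lambda>_. 1) q"
    using min_cost_awalk[OF reachable_verts, of u v "\<lambda>_. 1"] by auto
  then show ?thesis using min_cost_le_walk_cost[OF assms, of "\<lambda>_. 1"]
    by (simp add: graph_dist_def awalk_cost_unit)
qed

text \<open>Supplies nonnegativity and integrality; the latter turns a distance above 2 into one of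
  at least 3 when a packing is extended.\<close>

lemma graph_dist_nat: "u \<in> verts G \<Longrightarrow> v \<in> verts G \<Longrightarrow> \<exists>n :: nat. graph_dist G u v = n"
  by (metis graph_dist_awalk)

lemma graph_dist_refl:
  assumes "u \<in> verts G"
  shows "graph_dist G u u = 0"
proof -
  have "awalk u [] u" using assms by (simp add: awalk_Nil_iff)
  then have "graph_dist G u u \<le> 0" using graph_dist_le_length[of u "[]" u] by simp
  then show ?thesis using graph_dist_nat[OF assms assms] by auto
qed

lemma graph_dist_arc:
  assumes "u \<rightarrow>\<^bsub>G\<^esub> v"
  shows "graph_dist G u v \<le> 1"
proof -
  obtain e where "e \<in> arcs G" "tail G e = u" "head G e = v" using assms by blast
  then have "awalk u [e] v" by (auto simp: awalk_simps)
  from graph_dist_le_length[OF this] show ?thesis by simp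
qed

lemma graph_dist_triangle:
  assumes "u \<in> verts G" "v \<in> verts G" "w \<in> verts G"
  shows "graph_dist G u w \<le> graph_dist G u v + graph_dist G v w"
proof -
  obtain p q where "awalk u p v" "graph_dist G u v = length p"
    "awalk v q w" "graph_dist G v w = length q"
    using assms graph_dist_awalk by metis
  then show ?thesis using graph_dist_le_length[of u "p @ q" w] by auto
qed

lemma awalk_reverse: "awalk u p v \<Longrightarrow> \<exists>q. awalk v q u \<and> length q = length p"
proof (induction p arbitrary: u)
  case (Cons e p)
  then obtain q where q: "awalk v q (head G e)" "length q = length p" and
    e: "e \<in> arcs G" "tail G e = u" by (auto simp: awalk_Cons_iff)
  obtain e' where "e' \<in> arcs G" "tail G e' = head G e" "head G e' = u"
    using e sym_arcs unfolding symmetric_conv by metis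
  with q have "awalk v (q @ [e']) u \<and> length (q @ [e']) = length (e # p)"
    by (auto simp: awalk_simps)
  then show ?case by blast
qed (auto simp: awalk_Nil_iff)

lemma graph_dist_sym:
  assumes "u \<in> verts G" "v \<in> verts G"
  shows "graph_dist G u v = graph_dist G v u"
proof -
  have "graph_dist G x y \<le> graph_dist G y x" if "x \<in> verts G" "y \<in> verts G" for x y
    using graph_dist_awalk[OF that(2,1)] awalk_reverse graph_dist_le_length by metis
  then show ?thesis using assms by (intro antisym) auto
qed

text \<open>Each arc of a shortest walk changes \<open>f\<close> by at most 1. With the layer number
  as \<open>f\<close>, this gives the lower bounds on distances in layered graphs.\<close>

lemma lipschitz_le_graph_dist:
  fixes f :: "'a \<Rightarrow> real"
  assumes "\<And>u v. u \<rightarrow>\<^bsub>G\<^esub> v \<Longrightarrow> \<bar>f u - f v\<bar> \<le> 1" "u \<in> verts G" "v \<in> verts G"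
  shows "\<bar>f u - f v\<bar> \<le> graph_dist G u v"
proof -
  have "\<bar>f u - f v\<bar> \<le> length p" if "awalk u p v" for u v p
    using that
  proof (induction p arbitrary: u)
    case (Cons e p)
    then have "\<bar>f (head G e) - f v\<bar> \<le> length p" "u \<rightarrow>\<^bsub>G\<^esub> head G e"
      by (auto simp: awalk_Cons_iff intro: in_arcs_imp_in_arcs_ends)
    with assms(1) show ?case by fastforce
  qed (simp add: awalk_Nil_iff)
  then show ?thesis using graph_dist_awalk[OF assms(2,3)] by metis
qed

lemma graph_dist_le_eccentricity:
  "v \<in> verts G \<Longrightarrow> graph_dist G u v \<le> eccentricity G u"
  unfolding eccentricity_def by simp

lemma eccentricity_le:
  "(\<And>v. v \<in> verts G \<Longrightarrow> graph_dist G u v \<le> b) \<Longrightarrow> eccentricity G u \<le> b"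
  unfolding eccentricity_def using verts_nonempty by (intro Max.boundedI) auto

lemma card_neighbourhood: "u \<in> verts G \<Longrightarrow> out_degree G u + 1 \<le> card {v \<in> verts G. graph_dist G u v \<le> 1}"
proof -
  assume u: "u \<in> verts G"
  have "inj_on (head G) (out_arcs G u)"
    by (rule inj_onI) (auto intro: no_multi_arcs simp: arc_to_ends_def)
  then have "out_degree G u + 1 = card (insert u (head G ` out_arcs G u))"
    using no_loops by (subst card_insert_disjoint) (auto simp: out_degree_def card_image)
  also have "\<dots> \<le> card {v \<in> verts G. graph_dist G u v \<le> 1}"
    using u by (intro card_mono) (auto simp: graph_dist_refl intro!: graph_dist_arc in_arcs_imp_in_arcs_ends)
  finally show ?thesis .
qed

lemma min_degree_le: "u \<in> verts G \<Longrightarrow> min_degree G \<le> out_degree G u"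
  by (simp add: min_degree_def)

lemma max_degree_attained: "\<exists>u\<in>verts G. out_degree G u = max_degree G"
proof -
  have "max_degree G \<in> out_degree G ` verts G"
    unfolding max_degree_def using verts_nonempty by (intro Max_in) auto
  then show ?thesis by force
qed

section \<open>Greedy packings of closed neighbourhoods\<close>

inductive packing :: "'a \<Rightarrow> 'a set \<Rightarrow> bool" for r where
  root: "packing r {r}"
| extend: "\<lbrakk>packing r A; p \<in> A; x \<in> verts G; graph_dist G p x \<le> 3; \<forall>a\<in>A. 3 \<le> graph_dist G a x\<rbrakk>
    \<Longrightarrow> packing r (insert x A)"

lemma packing_subset: "packing r A \<Longrightarrow> r \<in> verts G \<Longrightarrow> A \<subseteq> verts G"
  by (induction rule: packing.induct) auto

lemma packing_root: "packing r A \<Longrightarrow> r \<in> A"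
  by (induction rule: packing.induct) auto

lemma packing_separated:
  "packing r A \<Longrightarrow> r \<in> verts G \<Longrightarrow> u \<in> A \<Longrightarrow> v \<in> A \<Longrightarrow> u \<noteq> v \<Longrightarrow> 3 \<le> graph_dist G u v"
proof (induction arbitrary: u v rule: packing.induct)
  case (extend A p x)
  then have "A \<subseteq> verts G" by (simp add: packing_subset)
  then show ?case using extend graph_dist_sym[of x v] by auto
qed simp

text \<open>The new vertex \<open>x\<close> becomes a leaf at \<open>p\<close>. Each tree edge thus
  stands for a distance of at most 3, and the triangle inequality adds these up along tree
  paths.\<close>

lemma packing_tree_metric:
  "packing r A \<Longrightarrow> r \<in> verts G \<Longrightarrow>
    \<exists>t. tree_metric A t \<and> (\<forall>u\<in>A. \<forall>v\<in>A. graph_dist G u v \<le> 3 * t u v)"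
proof (induction rule: packing.induct)
  case root
  then show ?case using tree_metric.single[of r] by (auto intro!: exI simp: graph_dist_refl)
next
  case (extend A p x)
  then obtain t where t: "tree_metric A t" "\<And>u v. u \<in> A \<Longrightarrow> v \<in> A \<Longrightarrow> graph_dist G u v \<le> 3 * t u v"
    by auto
  have A: "A \<subseteq> verts G" using extend packing_subset by blast
  have x: "x \<notin> A" using extend by (force simp: graph_dist_refl)
  let ?t = "\<lambda>u v. if u = x then if v = x then 0 else Suc (t p v)
           else if v = x then Suc (t u p) else t u v"
  have "graph_dist G u v \<le> 3 * ?t u v" if "u \<in> insert x A" "v \<in> insert x A" for u v
  proof -
    have 1: "graph_dist G x v \<le> 3 + 3 * t p v" if "v \<in> A" for v
    proof -
      have "graph_dist G x v \<le> graph_dist G x p + graph_dist G p v"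
        using that A extend by (intro graph_dist_triangle) auto
      moreover have "graph_dist G x p = graph_dist G p x"
        using A extend by (intro graph_dist_sym) auto
      ultimately show ?thesis using extend t(2)[of p v] that by simp
    qed
    have 2: "graph_dist G u x \<le> 3 + 3 * t u p" if "u \<in> A" for u
    proof -
      have "graph_dist G u x \<le> graph_dist G u p + graph_dist G p x"
        using that A extend by (intro graph_dist_triangle) auto
      then show ?thesis using extend t(2)[of u p] that by simp
    qed
    show ?thesis using that 1 2 t(2) x extend.hyps(3)
      by (auto simp: graph_dist_refl)
  qed
  then show ?case using tree_metric.leaf[OF t(1) extend.hyps(2) x] by (intro exI[of _ ?t]) blast
qed

text \<open>A packing of greatest cardinality dominates: on a walk from \<open>r\<close>, the first
  vertex farther than 2 from all of \<open>A\<close> would be at distance exactly 3 from an element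
  near its predecessor, and could be added.\<close>

lemma ex_dominating_packing:
  assumes r: "r \<in> verts G"
  obtains A where "packing r A" "\<And>v. v \<in> verts G \<Longrightarrow> \<exists>a\<in>A. graph_dist G a v \<le> 2"
proof -
  have "\<exists>A. packing r A \<and> (\<forall>B. packing r B \<longrightarrow> card B \<le> card A)"
    using packing.root[of r]
    by (rule ex_has_greatest_nat[where b = "Suc (card (verts G))"])
      (meson card_mono finite_verts packing_subset[OF _ r] le_imp_less_Suc)
  then obtain A where A: "packing r A" and max: "\<And>B. packing r B \<Longrightarrow> card B \<le> card A" by auto
  have sub: "A \<subseteq> verts G" using A r by (rule packing_subset)
  then have fin: "finite A" by (rule finite_subset) simp
  have "\<exists>a\<in>A. graph_dist G a v \<le> 2" if "v \<in> verts G" for v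
    using reachable_verts[OF r that]
  proof (induction rule: reachable_induct)
    case base
    then show ?case using packing_root[OF A] r by (force simp: graph_dist_refl)
  next
    case (step x y)
    then obtain a where a: "a \<in> A" "graph_dist G a x \<le> 2" by auto
    have xy: "x \<in> verts G" "y \<in> verts G" using step adj_in_verts by auto
    show ?case
    proof (rule ccontr)
      assume no: "\<not> ?thesis"
      have far: "\<forall>b\<in>A. 3 \<le> graph_dist G b y"
      proof
        fix b assume "b \<in> A"
        then obtain n :: nat where "graph_dist G b y = n" "2 < graph_dist G b y"
          using graph_dist_nat[of b y] sub xy no by force
        then show "3 \<le> graph_dist G b y" by simp
      qed
      have "graph_dist G a y \<le> graph_dist G a x + graph_dist G x y"
        using a sub xy by (intro graph_dist_triangle) auto
      then have "packing r (insert y A)"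
        using A a xy far graph_dist_arc[OF step(2)] by (intro packing.extend[of r A a y]) auto
      moreover have "y \<notin> A" using far xy by (force simp: graph_dist_refl)
      ultimately show False using max fin by fastforce
    qed
  qed
  with A show thesis by (rule that)
qed

lemma avec_le: "avec G \<le> avec_bound (card (verts G)) (min_degree G) (max_degree G) + 7"
proof -
  let ?V = "verts G" and ?d = "graph_dist G"
  define n where "n = real (card ?V)"
  define \<Delta> where "\<Delta> = real (max_degree G)"
  define D where "D = real (min_degree G) + 1"
  have n: "0 < n" using verts_nonempty by (simp add: n_def card_gt_0_iff)
  have D: "0 < D" by (simp add: D_def)
  obtain r where r: "r \<in> ?V" "out_degree G r = max_degree G" using max_degree_attained by auto
  obtain A where A: "packing r A" and dom: "\<And>v. v \<in> ?V \<Longrightarrow> \<exists>a\<in>A. ?d a v \<le> 2"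
    using ex_dominating_packing[OF r(1)] by blast
  note sub = packing_subset[OF A r(1)] and sep = packing_separated[OF A r(1)]
  have fin: "finite A" using sub by (rule finite_subset) simp
  obtain t where t: "tree_metric A t" "\<And>u v. u \<in> A \<Longrightarrow> v \<in> A \<Longrightarrow> ?d u v \<le> 3 * t u v"
    using packing_tree_metric[OF A r(1)] by blast
  \<comment> \<open>Each vertex goes to the element of \<open>A\<close> whose closed neighbourhood
    contains it, if there is one, and otherwise to some element within distance 2. Elements of
    \<open>A\<close> are at least 3 apart, so the first choice is unique.\<close>
  have "\<exists>a\<in>A. ?d a v \<le> 2 \<and> (\<forall>b\<in>A. ?d b v \<le> 1 \<longrightarrow> b = a)" if v: "v \<in> ?V" for v
  proof (cases "\<exists>a\<in>A. ?d a v \<le> 1")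
    case True
    then obtain a where a: "a \<in> A" "?d a v \<le> 1" by auto
    have "b = a" if b: "b \<in> A" "?d b v \<le> 1" for b
    proof (rule ccontr)
      assume "b \<noteq> a"
      moreover have "?d b a \<le> ?d b v + ?d v a" using a b v sub by (intro graph_dist_triangle) auto
      moreover have "?d v a = ?d a v" using a v sub by (intro graph_dist_sym) auto
      ultimately show False using sep[of b a] a b by simp
    qed
    moreover have "?d a v \<le> 2" using a by simp
    ultimately show ?thesis using a by blast
  next
    case False
    then show ?thesis using dom[OF v] by blast
  qed
  then obtain f where f: "\<And>v. v \<in> ?V \<Longrightarrow> f v \<in> A \<and> ?d (f v) v \<le> 2 \<and> (\<forall>b\<in>A. ?d b v \<le> 1 \<longrightarrow> b = f v)"
    by metis
  \<comment> \<open>The weight that \<open>a\<close> receives. The fibre of \<open>a\<close>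
    contains its closed neighbourhood.\<close>
  define c where "c a = real (card {v \<in> ?V. f v = a})" for a
  have c_deg: "real (out_degree G a) + 1 \<le> c a" if a: "a \<in> A" for a
  proof -
    have "out_degree G a + 1 \<le> card {v \<in> ?V. ?d a v \<le> 1}"
      using a sub by (intro card_neighbourhood) auto
    also have "\<dots> \<le> card {v \<in> ?V. f v = a}"
      using a f by (intro card_mono) auto
    finally show ?thesis unfolding c_def by linarith
  qed
  have c_D: "D \<le> c a" if a: "a \<in> A" for a
    using c_deg[OF a] min_degree_le[of a] a sub by (force simp: D_def)
  have fibres: "(\<Sum>v\<in>?V. g (f v)) = (\<Sum>a\<in>A. c a * g a)" for g :: "'a \<Rightarrow> real"
  proof -
    have "(\<Sum>v\<in>?V. g (f v)) = (\<Sum>a\<in>A. \<Sum>v\<in>{v \<in> ?V. f v = a}. g (f v))"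
      using f fin by (intro sum.group[symmetric]) auto
    also have "\<dots> = (\<Sum>a\<in>A. c a * g a)" by (intro sum.cong) (auto simp: c_def)
    finally show ?thesis .
  qed
  have c_sum: "(\<Sum>a\<in>A. c a) = n" using fibres[of "\<lambda>_. 1"] by (simp add: n_def)
  define e where "e u = real (Max (t u ` A))" for u
  \<comment> \<open>The number of edges of the tree on \<open>A\<close>.\<close>
  define x where "x = real (card A) - 1"
  have rA: "r \<in> A" using A by (rule packing_root)
  have x: "0 \<le> x" using rA fin unfolding x_def by (cases "card A") auto
  have e_le: "e u \<le> x" if "u \<in> A" for u
  proof -
    have "Max (t u ` A) \<in> t u ` A" using fin rA by (intro Max_in) auto
    then have "Max (t u ` A) < card A" using tree_metric_less_card[OF t(1) that] by auto
    then show ?thesis unfolding e_def x_def by linarith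
  qed
  \<comment> \<open>The 4 pays for moving both \<open>v\<close> and \<open>w\<close> by at most 2 to
    their images under \<open>f\<close>.\<close>
  have ecc: "eccentricity G v \<le> 4 + 3 * e (f v)" if v: "v \<in> ?V" for v
  proof (rule eccentricity_le)
    fix w assume w: "w \<in> ?V"
    have fv: "f v \<in> ?V" "f w \<in> ?V" using f sub v w by auto
    have "?d v w \<le> ?d v (f v) + ?d (f v) w" "?d (f v) w \<le> ?d (f v) (f w) + ?d (f w) w"
      using v w fv by (auto intro!: graph_dist_triangle)
    moreover have "?d v (f v) = ?d (f v) v" using v fv by (intro graph_dist_sym)
    moreover have "?d (f v) (f w) \<le> 3 * t (f v) (f w)" using t(2) f v w by simp
    moreover have "real (t (f v) (f w)) \<le> e (f v)"
      unfolding e_def using f v w fin by simp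
    ultimately show "?d v w \<le> 4 + 3 * e (f v)" using f[OF v] f[OF w] by simp
  qed
  have sum_e: "4 * (\<Sum>u\<in>A. e u) \<le> (3 * x + 5) * x"
  proof -
    have "real (4 * (\<Sum>u\<in>A. Max (t u ` A)) + card A + 2) \<le> real (3 * card A * card A)"
      using tree_metric_sum_Max_le[OF t(1)] of_nat_mono by blast
    then show ?thesis by (simp add: e_def x_def algebra_simps)
  qed
  \<comment> \<open>Weight \<open>D\<close> at each element is charged its tree eccentricity, the
    excess \<open>c a - D\<close> the upper bound \<open>x\<close>. The excess totals
    \<open>n - (x + 1) * D\<close>.\<close>
  have "(\<Sum>a\<in>A. c a * e a) = D * (\<Sum>a\<in>A. e a) + (\<Sum>a\<in>A. (c a - D) * e a)"
    by (simp add: sum_distrib_left sum.distrib[symmetric] algebra_simps)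
  also have "(\<Sum>a\<in>A. (c a - D) * e a) \<le> (\<Sum>a\<in>A. (c a - D) * x)"
    using c_D e_le by (intro sum_mono mult_left_mono) auto
  also have "(\<Sum>a\<in>A. (c a - D) * x) = (n - (x + 1) * D) * x"
    using c_sum by (simp add: sum_distrib_right[symmetric] sum_subtractf x_def)
  also have "D * (\<Sum>a\<in>A. e a) \<le> D * ((3 * x + 5) * x / 4)"
    using sum_e D by (intro mult_left_mono) auto
  finally have ce: "(\<Sum>a\<in>A. c a * e a) \<le> n * x - D * x\<^sup>2 / 4 + D * x / 4"
    by (simp add: field_simps power2_eq_square)
  have "(\<Sum>v\<in>?V. eccentricity G v) \<le> (\<Sum>v\<in>?V. 4 + 3 * e (f v))"
    by (rule sum_mono) (rule ecc)
  also have "\<dots> = 4 * n + 3 * (\<Sum>a\<in>A. c a * e a)"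
    by (simp add: sum.distrib sum_distrib_left[symmetric] fibres n_def)
  also have "\<dots> \<le> 4 * n + 3 * (n * x - D * x\<^sup>2 / 4 + D * x / 4)"
    using ce by simp
  finally have total: "(\<Sum>v\<in>?V. eccentricity G v) \<le> 4 * n + 3 * (n * x - D * x\<^sup>2 / 4 + D * x / 4)" .
  \<comment> \<open>An upper bound for \<open>x\<close>: the fibre of \<open>r\<close> has at least
    \<open>\<Delta> + 1\<close> vertices, the other \<open>x\<close> fibres at least
    \<open>D\<close> each.\<close>
  define m where "m = (n - \<Delta> - 1) / D"
  have mD: "m * D = n - \<Delta> - 1" using D by (simp add: m_def)
  have "\<Delta> + 1 + x * D \<le> n"
  proof -
    have "n = c r + (\<Sum>a\<in>A - {r}. c a)" using c_sum fin rA by (metis sum.remove)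
    moreover have "(\<Sum>a\<in>A - {r}. D) \<le> (\<Sum>a\<in>A - {r}. c a)" by (rule sum_mono) (use c_D in auto)
    moreover have "(\<Sum>a\<in>A - {r}. D) = x * D"
      using fin rA by (cases "card A") (auto simp: x_def)
    ultimately show ?thesis using c_deg[OF rA] unfolding \<Delta>_def r(2) by linarith
  qed
  then have "x * D \<le> m * D" using mD by simp
  then have xm: "x \<le> m" using D by simp
  have mn: "D * m \<le> n" using mD by (simp add: mult.commute \<Delta>_def)
  have xn: "D * x \<le> n" using mn xm D by (smt (verit) mult_left_mono)
  \<comment> \<open>The expression \<open>2 * n * y - D * y\<^sup>2\<close> does not decrease from
    \<open>y = x\<close> to \<open>y = m\<close>, because
    \<open>D * (m + x) \<le> 2 * n\<close>.\<close>
  have "D * (m + x) * (m - x) \<le> 2 * n * (m - x)"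
    using mn xn xm by (intro mult_right_mono) (auto simp: algebra_simps)
  then have quad: "D * m\<^sup>2 - D * x\<^sup>2 \<le> 2 * (n * m) - 2 * (n * x)"
    by (simp add: algebra_simps power2_eq_square)
  have nxm: "n * x \<le> n * m" using n xm by simp
  have "4 * n + 3 * (n * x - D * x\<^sup>2 / 4 + D * x / 4) =
      4 * n + 3 * (n * x) - 3 / 4 * (D * x\<^sup>2) + 3 / 4 * (D * x)"
    by simp
  \<comment> \<open>The terms linear in \<open>D * x\<close> and \<open>D * m\<close> are absorbed
    into \<open>3 * n\<close>. Together with the 4 from the eccentricities this makes the additive
    constant 7.\<close>
  also have "\<dots> \<le> 7 * n + 3 * (n * m) - 3 / 4 * (D * m\<^sup>2) - 3 / 4 * (D * m)"
    using quad nxm mn xn n by linarith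
  \<comment> \<open>A quarter of \<open>3 * (n * m)\<close> is split off and joined to the negative
    terms, because \<open>n - m * D - D\<close> is the difference between maximum and minimum
    degree.\<close>
  also have "\<dots> = n * (9 / 4 * m + 7) + 3 / 4 * m * (n - m * D - D)"
    by (simp add: field_simps power2_eq_square)
  also have "n - m * D - D = \<Delta> - (D - 1)" using mD by simp
  also have "n * (9 / 4 * m + 7) + 3 / 4 * m * (\<Delta> - (D - 1)) =
      n * (9 / 4 * m * (1 + (\<Delta> - (D - 1)) / (3 * n)) + 7)"
    using n by (simp add: field_simps)
  also have "9 / 4 * m * (1 + (\<Delta> - (D - 1)) / (3 * n)) =
      avec_bound (card ?V) (min_degree G) (max_degree G)"
    by (simp add: avec_bound_def m_def n_def \<Delta>_def D_def)
  finally show ?thesis using total n unfolding avec_def n_def[symmetric]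
    by (simp add: pos_divide_le_eq mult.commute)
qed

end

section \<open>Sharpness\<close>

abbreviation layer :: "nat \<Rightarrow> nat" where
  "layer v \<equiv> fst (prod_decode v)"

text \<open>Pairs of layer number and index are encoded as naturals to obtain the vertex type
  \<open>nat\<close> of the theorem. There are \<open>D + 1\<close> layers, and in the graph below
  each of them is a clique.\<close>

definition layered_verts :: "nat \<Rightarrow> (nat \<Rightarrow> nat) \<Rightarrow> nat set" where
  "layered_verts D s = prod_encode ` (SIGMA i:{..D}. {..<s i})"

definition layered_graph :: "nat \<Rightarrow> (nat \<Rightarrow> nat) \<Rightarrow> (nat, nat \<times> nat) pre_digraph" where
  "layered_graph D s =
    \<lparr>verts = layered_verts D s,
     arcs = {(u, v). u \<in> layered_verts D s \<and> v \<in> layered_verts D s \<and> u \<noteq> v \<and>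
              layer u \<le> layer v + 1 \<and> layer v \<le> layer u + 1},
     tail = fst, head = snd\<rparr>"

lemma layered_graph_simps [simp]:
  "verts (layered_graph D s) = layered_verts D s"
  "arcs (layered_graph D s) =
    {(u, v). u \<in> layered_verts D s \<and> v \<in> layered_verts D s \<and> u \<noteq> v \<and>
      layer u \<le> layer v + 1 \<and> layer v \<le> layer u + 1}"
  "tail (layered_graph D s) = fst" "head (layered_graph D s) = snd"
  by (simp_all add: layered_graph_def)

lemma finite_layered_verts [simp]: "finite (layered_verts D s)"
  by (simp add: layered_verts_def)

lemma in_layered_verts: "prod_encode (i, x) \<in> layered_verts D s \<longleftrightarrow> i \<le> D \<and> x < s i"
  by (auto simp: layered_verts_def)

lemma layer_le: "v \<in> layered_verts D s \<Longrightarrow> layer v \<le> D"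
  by (auto simp: layered_verts_def)

text \<open>Order, degrees and eccentricity sums all reduce to this, their summands depending on the
  layer only.\<close>

lemma sum_layered_verts:
  fixes f :: "nat \<Rightarrow> 'c :: comm_semiring_1"
  shows "(\<Sum>v\<in>layered_verts D s. f (layer v)) = (\<Sum>i\<le>D. of_nat (s i) * f i)"
proof -
  have "(\<Sum>v\<in>layered_verts D s. f (layer v)) = (\<Sum>p\<in>(SIGMA i:{..D}. {..<s i}). f (fst p))"
    unfolding layered_verts_def by (subst sum.reindex) (auto intro: inj_on_subset[OF inj_prod_encode])
  also have "\<dots> = (\<Sum>i\<le>D. \<Sum>x<s i. f i)"
    by (subst sum.Sigma) (auto simp: case_prod_beta)
  finally show ?thesis by simp
qed

lemma card_layered_verts: "card (layered_verts D s) = (\<Sum>i\<le>D. s i)"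
  using sum_layered_verts[of "\<lambda>_. 1 :: nat" D s] by simp

lemma graph_layered_graph: "graph (layered_graph D s)"
proof -
  have "finite {(u, v). u \<in> layered_verts D s \<and> v \<in> layered_verts D s \<and> u \<noteq> v \<and>
      layer u \<le> layer v + 1 \<and> layer v \<le> layer u + 1}"
    by (rule finite_subset[of _ "layered_verts D s \<times> layered_verts D s"]) auto
  moreover have "symmetric (layered_graph D s)"
    unfolding symmetric_conv by auto
  ultimately show ?thesis
    by unfold_locales (auto simp: arc_to_ends_def)
qed

text \<open>The closed neighbourhood of \<open>v\<close> consists of whole layers; the 1 accounts
  for \<open>v\<close> itself.\<close>

lemma out_degree_layered_graph:
  assumes v: "v \<in> layered_verts D s"
  shows "out_degree (layered_graph D s) v + 1 =
    (\<Sum>i\<in>{i. i \<le> D \<and> i \<le> layer v + 1 \<and> layer v \<le> i + 1}. s i)"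
proof -
  let ?N = "{u \<in> layered_verts D s. layer u \<le> layer v + 1 \<and> layer v \<le> layer u + 1}"
  have "out_arcs (layered_graph D s) v = Pair v ` (?N - {v})"
    using v by (auto simp: out_arcs_def)
  then have "out_degree (layered_graph D s) v = card (?N - {v})"
    by (simp add: out_degree_def card_image inj_on_def)
  moreover have "card ?N = Suc (card (?N - {v}))" using v by (intro card.remove) auto
  ultimately have "out_degree (layered_graph D s) v + 1 = card ?N" by (simp only: Suc_eq_plus1)
  also have "\<dots> = (\<Sum>u\<in>layered_verts D s. if layer u \<le> layer v + 1 \<and> layer v \<le> layer u + 1 then 1 else 0)"
    by (simp add: sum.inter_filter[symmetric])
  also have "\<dots> = (\<Sum>i\<le>D. s i * (if i \<le> layer v + 1 \<and> layer v \<le> i + 1 then 1 else 0))"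
    using sum_layered_verts[of "\<lambda>i. if i \<le> layer v + 1 \<and> layer v \<le> i + 1 then 1 else 0 :: nat" D s]
    by simp
  also have "\<dots> = (\<Sum>i\<le>D. if i \<le> layer v + 1 \<and> layer v \<le> i + 1 then s i else 0)"
    by (intro sum.cong) auto
  also have "\<dots> = (\<Sum>i\<in>{i \<in> {..D}. i \<le> layer v + 1 \<and> layer v \<le> i + 1}. s i)"
    by (simp only: sum.inter_filter finite_atMost)
  finally show ?thesis by simp
qed

lemma out_degree_layered_graph_first:
  "v \<in> layered_verts D s \<Longrightarrow> layer v = 0 \<Longrightarrow> 0 < D \<Longrightarrow>
    out_degree (layered_graph D s) v + 1 = s 0 + s 1"
proof -
  assume v: "v \<in> layered_verts D s" "layer v = 0" "0 < D"
  then have "{i. i \<le> D \<and> i \<le> layer v + 1 \<and> layer v \<le> i + 1} = {0, 1}" by auto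
  with out_degree_layered_graph[OF v(1)] show ?thesis by simp
qed

lemma out_degree_layered_graph_last:
  "v \<in> layered_verts D s \<Longrightarrow> layer v = D \<Longrightarrow> 0 < D \<Longrightarrow>
    out_degree (layered_graph D s) v + 1 = s (D - 1) + s D"
proof -
  assume v: "v \<in> layered_verts D s" "layer v = D" "0 < D"
  then have "{i. i \<le> D \<and> i \<le> layer v + 1 \<and> layer v \<le> i + 1} = {D - 1, D}" by auto
  with out_degree_layered_graph[OF v(1)] v(3) show ?thesis by simp
qed

lemma out_degree_layered_graph_inner:
  "v \<in> layered_verts D s \<Longrightarrow> layer v = Suc i \<Longrightarrow> Suc i < D \<Longrightarrow>
    out_degree (layered_graph D s) v + 1 = s i + s (Suc i) + s (Suc (Suc i))"
proof -
  assume v: "v \<in> layered_verts D s" "layer v = Suc i" "Suc i < D"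
  then have "{j. j \<le> D \<and> j \<le> layer v + 1 \<and> layer v \<le> j + 1} = {i, Suc i, Suc (Suc i)}" by auto
  with out_degree_layered_graph[OF v(1)] show ?thesis by simp
qed

text \<open>A vertex beyond layer 0 is adjacent to the vertex of index 0 in the preceding layer, so
  induction on the layer reaches it from \<open>prod_encode (0, 0)\<close>.\<close>

lemma connected_layered_graph:
  assumes s: "\<And>i. i \<le> D \<Longrightarrow> 0 < s i"
  shows "Digraph_Component.connected (layered_graph D s)"
proof -
  let ?G = "layered_graph D s"
  interpret graph ?G by (rule graph_layered_graph)
  have root: "prod_encode (0, 0) \<rightarrow>\<^sup>*\<^bsub>?G\<^esub> v" if "v \<in> verts ?G" for v
    using that
  proof (induction "layer v" arbitrary: v)
    case 0
    show ?case
    proof (cases "v = prod_encode (0, 0)")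
      case False
      then have "(prod_encode (0, 0), v) \<in> arcs ?G" using 0 s by (auto simp: in_layered_verts)
      from in_arcs_imp_in_arcs_ends[OF this] show ?thesis by auto
    qed (use 0 in auto)
  next
    case (Suc i)
    let ?u = "prod_encode (i, 0)"
    have "i \<le> D" using Suc layer_le[of v D s] by simp
    then have u: "?u \<in> verts ?G" using s by (simp add: in_layered_verts)
    then have "(?u, v) \<in> arcs ?G" using Suc by auto
    from in_arcs_imp_in_arcs_ends[OF this] have "?u \<rightarrow>\<^bsub>?G\<^esub> v" by simp
    moreover have "prod_encode (0, 0) \<rightarrow>\<^sup>*\<^bsub>?G\<^esub> ?u" using Suc(1)[of ?u] u by simp
    ultimately show ?case by (rule reachable_adj_trans[rotated])
  qed
  have "strongly_connected ?G"
  proof (rule strongly_connectedI)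
    show "verts ?G \<noteq> {}" using s[of 0] in_layered_verts[of 0 0 D s] by auto
    fix u v assume "u \<in> verts ?G" "v \<in> verts ?G"
    then show "u \<rightarrow>\<^sup>*\<^bsub>?G\<^esub> v" using root symmetric_reachable'[OF root] reachable_trans by blast
  qed
  then show ?thesis
    by (auto simp: Digraph_Component.connected_def strongly_connected_def reachable_mk_symmetric_eq[OF sym_arcs])
qed

text \<open>The layer number changes by at most 1 along an arc, and layers \<open>0\<close> and
  \<open>D\<close> are nonempty.\<close>

lemma eccentricity_layered_graph:
  assumes s: "\<And>i. i \<le> D \<Longrightarrow> 0 < s i" and v: "v \<in> layered_verts D s"
  shows "max (real (layer v)) (real D - real (layer v)) \<le> eccentricity (layered_graph D s) v"
proof -
  let ?G = "layered_graph D s"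
  interpret graph ?G by (rule graph_layered_graph)
  interpret connected_graph ?G
    by unfold_locales (rule connected_layered_graph[OF s])
  have lip: "\<bar>real (layer x) - real (layer y)\<bar> \<le> 1" if "x \<rightarrow>\<^bsub>?G\<^esub> y" for x y
  proof -
    obtain e where "e \<in> arcs ?G" "tail ?G e = x" "head ?G e = y" using \<open>x \<rightarrow>\<^bsub>?G\<^esub> y\<close> by blast
    then show ?thesis by auto
  qed
  have "\<bar>real (layer v) - real i\<bar> \<le> eccentricity ?G v" if "i \<le> D" for i
  proof -
    have u: "prod_encode (i, 0) \<in> verts ?G" using that s by (simp add: in_layered_verts)
    have "\<bar>real (layer v) - real (layer (prod_encode (i, 0)))\<bar> \<le> graph_dist ?G v (prod_encode (i, 0))"
      by (rule lipschitz_le_graph_dist[where f = "\<lambda>x. real (layer x)"]) (use lip u v in auto)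
    also have "\<dots> \<le> eccentricity ?G v" by (rule graph_dist_le_eccentricity[OF u])
    finally show ?thesis by simp
  qed
  from this[of 0] this[of D] show ?thesis by simp
qed

lemma sum_eccentricity_layered_graph:
  assumes s: "\<And>i. i \<le> D \<Longrightarrow> 0 < s i"
  shows "(\<Sum>i\<le>D. real (s i) * max (real i) (real D - real i)) \<le>
    (\<Sum>v\<in>layered_verts D s. eccentricity (layered_graph D s) v)"
proof -
  have "(\<Sum>i\<le>D. real (s i) * max (real i) (real D - real i)) =
      (\<Sum>v\<in>layered_verts D s. max (real (layer v)) (real D - real (layer v)))"
    by (rule sum_layered_verts[symmetric])
  also have "\<dots> \<le> (\<Sum>v\<in>layered_verts D s. eccentricity (layered_graph D s) v)"
    by (rule sum_mono) (rule eccentricity_layered_graph[OF s])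
  finally show ?thesis .
qed

section \<open>Sums over triples of layers, and the extremal graph\<close>

lemma sum_triples:
  fixes g :: "nat \<Rightarrow> 'c :: comm_monoid_add"
  shows "(\<Sum>i\<le>3 * k. g i) = g 0 + (\<Sum>j<k. g (3 * j + 1) + g (3 * j + 2) + g (3 * j + 3))"
proof (induction k)
  case (Suc k)
  have "3 * Suc k = Suc (Suc (Suc (3 * k)))" by simp
  then have "(\<Sum>i\<le>3 * Suc k. g i) = (\<Sum>i\<le>3 * k. g i) + g (3 * k + 1) + g (3 * k + 2) + g (3 * k + 3)"
    by (simp add: eval_nat_numeral)
  with Suc show ?case by (simp add: ac_simps)
qed simp

text \<open>The summands are the eccentricities in a path on \<open>2 * r\<close> vertices. Pairing
  \<open>j\<close> with \<open>r + j\<close> gives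
  \<open>(2 * r - 1 - j) + (r + j) = 3 * r - 1\<close> for each of \<open>r\<close> pairs.\<close>

lemma sum_max_ge:
  "real r * (3 * real r - 1) \<le> (\<Sum>j<2 * r. max (real j) (2 * real r - 1 - real j))"
proof -
  let ?h = "\<lambda>j. max (real j) (2 * real r - 1 - real j)"
  have split: "(\<Sum>j<r + m. ?h j) = (\<Sum>j<r. ?h j) + (\<Sum>j<m. ?h (r + j))" for m
    by (induction m) auto
  have "real r * (3 * real r - 1) = (\<Sum>j<r. 3 * real r - 1)" by simp
  also have "\<dots> = (\<Sum>j<r. (2 * real r - 1 - real j) + real (r + j))"
    by (intro sum.cong) auto
  also have "\<dots> \<le> (\<Sum>j<r. ?h j + ?h (r + j))"
    by (intro sum_mono add_mono) auto
  also have "\<dots> = (\<Sum>j<r + r. ?h j)"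
    by (simp only: split sum.distrib)
  finally show ?thesis by (simp only: mult_2)
qed

text \<open>
  The last layer needs one vertex more, because it has no successor. Its predecessor then has
  degree \<open>\<delta> + 1\<close>, whence the hypothesis \<open>\<delta> + 1 \<le> \<Delta>\<close>.
\<close>

definition extremal_layers :: "nat \<Rightarrow> nat \<Rightarrow> nat \<Rightarrow> nat \<Rightarrow> nat" where
  "extremal_layers \<delta> \<Delta> k i =
    (if i = 0 then \<Delta> - 1 else if i = 3 * k then \<delta> else if 3 dvd i then \<delta> - 1 else 1)"

lemma extremal_layers_simps:
  "extremal_layers \<delta> \<Delta> k 0 = \<Delta> - 1"
  "extremal_layers \<delta> \<Delta> k (3 * j + 1) = 1"
  "extremal_layers \<delta> \<Delta> k (3 * j + 2) = 1"
  "extremal_layers \<delta> \<Delta> k (3 * j + 3) = (if j + 1 = k then \<delta> else \<delta> - 1)"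
proof -
  show "extremal_layers \<delta> \<Delta> k 0 = \<Delta> - 1" by (simp add: extremal_layers_def)
  have "\<not> 3 dvd 3 * j + 1" "3 * j + 1 \<noteq> 3 * k" by presburger+
  then show "extremal_layers \<delta> \<Delta> k (3 * j + 1) = 1" by (simp add: extremal_layers_def)
  have "\<not> 3 dvd 3 * j + 2" "3 * j + 2 \<noteq> 3 * k" by presburger+
  then show "extremal_layers \<delta> \<Delta> k (3 * j + 2) = 1" by (simp add: extremal_layers_def)
  have "3 dvd 3 * j + 3" "3 * j + 3 = 3 * k \<longleftrightarrow> j + 1 = k" by presburger+
  then show "extremal_layers \<delta> \<Delta> k (3 * j + 3) = (if j + 1 = k then \<delta> else \<delta> - 1)"
    by (simp add: extremal_layers_def)
qed

lemma extremal_graph: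
  fixes \<delta> \<Delta> N :: nat
  assumes "2 \<le> \<delta>" "\<delta> + 1 \<le> \<Delta>"
  defines "r \<equiv> N + 1"
  defines "G \<equiv> layered_graph (3 * (2 * r)) (extremal_layers \<delta> \<Delta> (2 * r))"
  shows "graph G" "Digraph_Component.connected G" "min_degree G = \<delta>" "max_degree G = \<Delta>"
    "N \<le> card (verts G)" "avec_bound (card (verts G)) \<delta> \<Delta> - 3 \<le> avec G"
proof -
  \<comment> \<open>The number of triples of layers, even so that \<open>sum_max_ge\<close>
    applies.\<close>
  define k where "k = 2 * r"
  define s where "s = extremal_layers \<delta> \<Delta> k"
  have G: "G = layered_graph (3 * k) s" by (simp add: G_def s_def k_def)
  note s_simps = extremal_layers_simps[of \<delta> \<Delta> k, folded s_def]
  have k: "0 < k" by (simp add: k_def r_def)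
  have s_pos: "0 < s i" for i using assms by (auto simp: s_def extremal_layers_def)
  have triple: "\<exists>j<k. i = 3 * j + 1 \<or> i = 3 * j + 2 \<or> i = 3 * j + 3" if "i \<le> 3 * k" "i \<noteq> 0" for i
    using that by presburger
  show "graph G" unfolding G by (rule graph_layered_graph)
  show "Digraph_Component.connected G" unfolding G by (rule connected_layered_graph) (rule s_pos)
  have V: "verts G = layered_verts (3 * k) s" by (simp add: G)
  have deg0: "out_degree G v = \<Delta> - 1" if "v \<in> verts G" "layer v = 0" for v
    using out_degree_layered_graph_first[of v "3 * k" s] that k s_simps(1) s_simps(2)[of 0]
    by (simp add: G)
  \<comment> \<open>For \<open>j = 0\<close> the preceding layer is the large clique, and the
    maximum degree is attained.\<close>
  have deg1: "out_degree G v = (if j = 0 then \<Delta> else \<delta>)"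
    if "v \<in> verts G" "layer v = 3 * j + 1" "j < k" for v j
  proof -
    have "s (3 * j) = (if j = 0 then \<Delta> - 1 else \<delta> - 1)"
      using s_simps(1) s_simps(4)[of "j - 1"] that(3) by (cases j) (auto simp: algebra_simps)
    then show ?thesis
      using out_degree_layered_graph_inner[of v "3 * k" s "3 * j"] that s_simps(2,3)[of j] assms
      by (auto simp: G)
  qed
  have deg2: "out_degree G v = (if j + 1 = k then \<delta> + 1 else \<delta>)"
    if "v \<in> verts G" "layer v = 3 * j + 2" "j < k" for v j
    using out_degree_layered_graph_inner[of v "3 * k" s "3 * j + 1"] that s_simps(2,3,4)[of j] assms
    by (auto simp: G eval_nat_numeral)
  have deg3: "out_degree G v = \<delta>"
    if "v \<in> verts G" "layer v = 3 * j + 3" "j < k" for v j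
  proof (cases "j + 1 = k")
    case True
    then have "3 * k = 3 * j + 3" "3 * k - 1 = 3 * j + 2" by auto
    then show ?thesis
      using out_degree_layered_graph_last[of v "3 * k" s] that s_simps(3,4)[of j] True
      by (simp only: G layered_graph_simps) simp
  next
    case False
    then show ?thesis
      using out_degree_layered_graph_inner[of v "3 * k" s "3 * j + 2"] that
        s_simps(3,4)[of j] s_simps(2)[of "j + 1"] assms
      by (simp add: G eval_nat_numeral)
  qed
  have deg: "\<delta> \<le> out_degree G v \<and> out_degree G v \<le> \<Delta>" if v: "v \<in> verts G" for v
  proof (cases "layer v = 0")
    case True
    then show ?thesis using deg0[OF v] assms by simp
  next
    case False
    have "layer v \<le> 3 * k" using v layer_le by (simp add: V)
    from triple[OF this False] obtain j
      where j: "j < k" "layer v = 3 * j + 1 \<or> layer v = 3 * j + 2 \<or> layer v = 3 * j + 3" by blast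
    from j(2) show ?thesis
      using deg1[OF v _ j(1)] deg2[OF v _ j(1)] deg3[OF v _ j(1)] assms by (elim disjE) auto
  qed
  have fin: "finite (verts G)" by (simp add: V)
  have "out_degree G (prod_encode (3 * k, 0)) = \<delta>"
    using deg3[of "prod_encode (3 * k, 0)" "k - 1"] k s_pos by (simp add: V in_layered_verts algebra_simps)
  moreover have last: "prod_encode (3 * k, 0) \<in> verts G" using s_pos by (simp add: V in_layered_verts)
  ultimately have "\<delta> \<in> out_degree G ` verts G" by force
  then show "min_degree G = \<delta>"
    unfolding min_degree_def using fin deg by (intro Min_eqI) auto
  have "prod_encode (1, 0) \<in> verts G" using s_pos k by (simp add: V in_layered_verts)
  moreover from this have "out_degree G (prod_encode (1, 0)) = \<Delta>"
    using deg1[of "prod_encode (1, 0)" 0] k by simp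
  ultimately have "\<Delta> \<in> out_degree G ` verts G" by force
  then show "max_degree G = \<Delta>"
    unfolding max_degree_def using fin deg by (intro Max_eqI) auto
  have "card (verts G) = (\<Sum>i\<le>3 * k. s i)" by (simp add: V card_layered_verts)
  \<comment> \<open>The additional vertex of the last layer is the 1 for \<open>j + 1 = k\<close>;
    in the total it turns \<open>\<Delta> - 1\<close> into \<open>\<Delta>\<close>.\<close>
  also have "\<dots> = (\<Delta> - 1) + (\<Sum>j<k. \<delta> + 1 + (if j + 1 = k then 1 else 0))"
    unfolding sum_triples s_simps by (rule arg_cong[OF sum.cong]) (use assms(1,2) in auto)
  also have "(\<Sum>j<k. \<delta> + 1 + (if j + 1 = k then 1 else 0)) = k * (\<delta> + 1) + (\<Sum>j<k. if j = k - 1 then 1 else 0)"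
    unfolding sum.distrib using k by (intro arg_cong2[of _ _ _ _ "(+)"] sum.cong) auto
  also have "(\<Sum>j<k. if j = k - 1 then 1 else 0) = (1 :: nat)" using k by simp
  finally have card: "card (verts G) = \<Delta> + k * (\<delta> + 1)" using assms by simp
  then show "N \<le> card (verts G)" by (simp add: k_def r_def)
  let ?E = "\<lambda>i. max (real i) (real (3 * k) - real i)"
  let ?h = "\<lambda>j. max (real j) (2 * real r - 1 - real j)"
  \<comment> \<open>The clique has \<open>\<Delta> - 1\<close> vertices at distance
    \<open>3 * k\<close> from the last layer. Triple \<open>j\<close> has at least
    \<open>\<delta> + 1\<close> vertices, each with eccentricity at least
    \<open>3 * ?h j\<close>.\<close>
  have "3 * real k * (real \<Delta> - 1) + (real \<delta> + 1) * (3 * (\<Sum>j<k. ?h j)) =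
      3 * real k * (real \<Delta> - 1) + (\<Sum>j<k. (real \<delta> + 1) * (3 * ?h j))"
    by (simp add: sum_distrib_left)
  also have "\<dots> \<le> real (s 0) * ?E 0 + (\<Sum>j<k. real (s (3 * j + 1)) * ?E (3 * j + 1) +
      real (s (3 * j + 2)) * ?E (3 * j + 2) + real (s (3 * j + 3)) * ?E (3 * j + 3))"
  proof (intro add_mono sum_mono)
    show "3 * real k * (real \<Delta> - 1) \<le> real (s 0) * ?E 0"
      using assms by (simp add: s_simps of_nat_diff algebra_simps)
    fix j assume "j \<in> {..<k}"
    have E: "3 * ?h j \<le> ?E (3 * j + 1)" "3 * ?h j \<le> ?E (3 * j + 2)" "3 * ?h j \<le> ?E (3 * j + 3)"
      by (auto simp: k_def max_def)
    have "0 \<le> ?h j" by (simp add: le_max_iff_disj)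
    have "(real \<delta> + 1) * (3 * ?h j) = 1 * (3 * ?h j) + 1 * (3 * ?h j) + (real \<delta> - 1) * (3 * ?h j)"
      by (simp add: algebra_simps)
    also have "\<dots> \<le> real (s (3 * j + 1)) * ?E (3 * j + 1) +
      real (s (3 * j + 2)) * ?E (3 * j + 2) + real (s (3 * j + 3)) * ?E (3 * j + 3)"
      unfolding s_simps using assms E \<open>0 \<le> ?h j\<close>
      by (intro add_mono mult_mono) (auto simp: of_nat_diff)
    finally show "(real \<delta> + 1) * (3 * ?h j) \<le> real (s (3 * j + 1)) * ?E (3 * j + 1) +
      real (s (3 * j + 2)) * ?E (3 * j + 2) + real (s (3 * j + 3)) * ?E (3 * j + 3)" .
  qed
  also have "\<dots> = (\<Sum>i\<le>3 * k. real (s i) * ?E i)" by (rule sum_triples[symmetric])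
  also have "\<dots> \<le> (\<Sum>v\<in>verts G. eccentricity G v)"
    unfolding V unfolding G by (rule sum_eccentricity_layered_graph) (rule s_pos)
  finally have 1: "3 * real k * (real \<Delta> - 1) + (real \<delta> + 1) * (3 * (\<Sum>j<k. ?h j))
    \<le> (\<Sum>v\<in>verts G. eccentricity G v)" .
  have 2: "(real \<delta> + 1) * (3 * (real r * (3 * real r - 1))) \<le> (real \<delta> + 1) * (3 * (\<Sum>j<k. ?h j))"
    using sum_max_ge[of r] by (intro mult_left_mono) (auto simp: k_def)
  from order_trans[OF add_left_mono[OF 2] 1] have total: "6 * real r * (real \<Delta> - 1) + (real \<delta> + 1) * (3 * (real r * (3 * real r - 1)))
    \<le> (\<Sum>v\<in>verts G. eccentricity G v)" by (simp add: k_def)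
  define n where "n = real (card (verts G))"
  have n: "n = real \<Delta> + 2 * real r * (real \<delta> + 1)" by (simp add: n_def card k_def algebra_simps)
  have n_pos: "0 < n" using assms unfolding n by (intro add_pos_nonneg) auto
  \<comment> \<open>Chosen so that \<open>n\<close> times the bound is
    \<open>9 / 4 * (q * w)\<close>; \<open>q\<close> falls short of \<open>2 * r\<close> by
    \<open>1 / (\<delta> + 1)\<close> only.\<close>
  define q where "q = (n - real \<Delta> - 1) / (real \<delta> + 1)"
  define w where "w = n + (real \<Delta> - real \<delta>) / 3"
  have "q \<le> 2 * real r"
    by (simp add: q_def n pos_divide_le_eq)
  moreover have "0 \<le> w" using assms(2) n_pos by (simp add: w_def)
  ultimately have qw: "q * w \<le> 2 * real r * w"
    by (rule mult_right_mono)
  \<comment> \<open>The terms in \<open>r * \<Delta>\<close> and \<open>r * r\<close> cancel.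
    Without \<open>- 3 * n\<close> the left side is too large by
    \<open>3 / 2 * r * \<delta> + 9 * r\<close>, which \<open>3 * n\<close> covers because
    \<open>2 * r \<le> r * \<delta>\<close>. This is why the constant 3 works.\<close>
  have rw: "9 / 4 * (2 * real r * w) - 3 * n
    \<le> 6 * real r * (real \<Delta> - 1) + (real \<delta> + 1) * (3 * (real r * (3 * real r - 1)))"
  proof -
    have "real r * 2 \<le> real r * real \<delta>" using assms(1) by (intro mult_left_mono) auto
    then show ?thesis unfolding w_def n by (simp add: field_simps)
  qed
  have "avec_bound (card (verts G)) \<delta> \<Delta> = 9 / 4 * q * (1 + (real \<Delta> - real \<delta>) / (3 * n))"
    by (simp add: avec_bound_def q_def n_def)
  also have "n * (\<dots> - 3) = 9 / 4 * (q * w) - 3 * n"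
    using n_pos by (simp add: w_def field_simps)
  finally have "n * (avec_bound (card (verts G)) \<delta> \<Delta> - 3) \<le> (\<Sum>v\<in>verts G. eccentricity G v)"
    using total qw rw by linarith
  then show "avec_bound (card (verts G)) \<delta> \<Delta> - 3 \<le> avec G"
    using n_pos unfolding avec_def n_def[symmetric] by (simp add: pos_le_divide_eq mult.commute)
qed

theorem theorem1:
  shows "(\<forall>G :: ('a, 'b) pre_digraph. graph G \<and> Digraph_Component.connected G \<longrightarrow>
            avec G \<le> avec_bound (card (verts G)) (min_degree G) (max_degree G) + 7)
       \<and> (\<exists>C :: real. \<forall>\<delta> \<Delta> N :: nat. 2 \<le> \<delta> \<and> \<delta> + 1 \<le> \<Delta> \<longrightarrow>
            (\<exists>G :: (nat, nat \<times> nat) pre_digraph. graph G \<and> Digraph_Component.connected G \<and>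
               min_degree G = \<delta> \<and> max_degree G = \<Delta> \<and> N \<le> card (verts G) \<and>
               avec_bound (card (verts G)) \<delta> \<Delta> - C \<le> avec G))"
proof (intro conjI allI impI exI[of _ 3])
  fix G :: "('a, 'b) pre_digraph"
  assume "graph G \<and> Digraph_Component.connected G"
  then have "connected_graph G"
    by (simp add: connected_graph_def connected_graph_axioms_def)
  then show "avec G \<le> avec_bound (card (verts G)) (min_degree G) (max_degree G) + 7"
    by (rule connected_graph.avec_le)
next
  fix \<delta> \<Delta> N :: nat
  assume "2 \<le> \<delta> \<and> \<delta> + 1 \<le> \<Delta>"
  then show "\<exists>G :: (nat, nat \<times> nat) pre_digraph. graph G \<and> Digraph_Component.connected G \<and>
      min_degree G = \<delta> \<and> max_degree G = \<Delta> \<and> N \<le> card (verts G) \<and>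
      avec_bound (card (verts G)) \<delta> \<Delta> - 3 \<le> avec G"
    using extremal_graph[of \<delta> \<Delta> N] by blast
qed

end
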